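(* Let $\gamma\in Z$ satisfy $\gamma\prec\gamma'$, where $\gamma'_n=\frac{\nu_n}{\nu_{n-1}}$, i.e. $\lim_{\mathcal U}\frac{\gamma_n\nu_{n-1}}{\nu_n}=0$. Then $\|\pi_\gamma(a)\|\le\limsup_{n\to\infty}\|\rho_n(a)\|$ for any $a\in\mathbb C[G]$.
   Context: Let $G$ be a residually finite (discrete) group with normal subgroups of finite index $G\supset G_1\supset G_2\supset\cdots$, strictly decreasing, such that $\cap_{n\in\mathbb N}G_n=\{e\}$. Put $X_n=G/G_n$ (a finite group on which $G$ acts by left translation, $(g,x)\mapsto gx$) and $\nu_n=|X_n|$; thus $\nu_{n+1}/\nu_n\ge 2$. Let $l^2(X_n)$ be the finite-dimensional Hilbert space with respect to counting measure on $X_n$, and let $\lambda_n$ be the quasi-regular representation of $G$ on $l^2(X_n)$, $(\lambda_n(g)\xi)(x)=\xi(g^{-1}x)$. Fix a non-principal ultrafilter $\mathcal U$ on $\mathbb N$. Let $\widetilde H=\{\xi=(\xi_n)_{n\in\mathbb N}:\xi_n\in l^2(X_n),\ \sup_n\|\xi_n\|<\infty\}$ with the sesquilinear form $\langle\xi,\eta\rangle=\lim_{\mathcal U}\langle\xi_n,\eta_n\rangle$, let $\widetilde H_0=\{\xi\in\widetilde H:\langle\xi,\xi\rangle=0\}$, and let $\widehat H$ be the Hilbert space completion of $\widetilde H/\widetilde H_0$. The formula $\widehat\lambda(g)(\xi_n)_{n}=(\lambda_n(g)\xi_n)_{n}$, $g\in G$, defines a unitary representation $\widehat\lambda$ of $G$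 on $\widehat H$. Let $Z$ be the set of all non-decreasing integer-valued sequences $\gamma=(\gamma_n)_{n\in\mathbb N}$ with $1\le\gamma_n\le\nu_n$ for all $n$ (growth functions). Write $\gamma\prec\gamma'$ if $\lim_{\mathcal U}\frac{\gamma_n}{\gamma'_n}=0$. For $\gamma\in Z$ and $k\in\mathbb N$ let $\widetilde H^{(k)}_\gamma\subset\widetilde H$ be the set of all sequences $(\xi_n)$ with $|\operatorname{supp}\xi_n|\le k\gamma_n$ for each $n$; let $\widetilde H_\gamma=\cup_{k=1}^\infty\widetilde H^{(k)}_\gamma$ (a linear subspace), and let $H_\gamma$ be the closure of $(\widetilde H_\gamma+\widetilde H_0)/\widetilde H_0$ in $\widehat H$. The subspace $H_\gamma$ is invariant under $\widehat\lambda$, and $\pi_\gamma=\widehat\lambda|_{H_\gamma}$. Representations of $G$ are extended linearly to $\mathbb C[G]$. For $n\ge2$ let $q_n:X_n=G/G_n\to X_{n-1}=G/G_{n-1}$ be the quotient homomorphism and let $U_{n-1}:l^2(X_{n-1})\to l^2(X_n)$ be the isometry $U_{n-1}(\xi)(x)=\frac{1}{\sqrt{\nu_n/\nu_{n-1}}}\,\xi(q_n(x))$. It intertwines $\lambda_{n-1}$ and $\lambda_n$, and $l^2(X_{n-1})$ is regarded via $U_{n-1}$ as a subspace of $l^2(X_n)$. The representation $\rho_n=\lambda_n\ominus\lambda_{n-1}$ is the restriction of $\lambda_n$ to the orthogonal complement $l^2(X_n)\ominus l^2(X_{n-1})$. *)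

theory Defs
  imports "HOL-Analysis.Analysis" "HOL-Algebra.Coset"
begin

section \<open>Complex Hilbert spaces\<close>

text \<open>The inner product is linear in the first argument.\<close>

class chilbert_space = banach +
  fixes scaleC :: "complex \<Rightarrow> 'a \<Rightarrow> 'a"  (infixr \<open>*\<^sub>C\<close> 75)
    and cinner :: "'a \<Rightarrow> 'a \<Rightarrow> complex"
  assumes scaleC_add_right: "c *\<^sub>C (x + y) = c *\<^sub>C x + c *\<^sub>C y"
    and scaleC_add_left: "(c + d) *\<^sub>C x = c *\<^sub>C x + d *\<^sub>C x"
    and scaleC_scaleC: "c *\<^sub>C (d *\<^sub>C x) = (c * d) *\<^sub>C x"
    and scaleR_scaleC: "r *\<^sub>R x = complex_of_real r *\<^sub>C x"
    and cinner_commute: "cinner x y = cnj (cinner y x)"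
    and cinner_add_left: "cinner (x + y) z = cinner x z + cinner y z"
    and cinner_scaleC_left: "cinner (c *\<^sub>C x) y = c * cinner x y"
    and norm_eq_sqrt_cinner: "norm x = sqrt (Re (cinner x x))"

instantiation complex :: chilbert_space
begin

definition scaleC_complex :: "complex \<Rightarrow> complex \<Rightarrow> complex"
  where "scaleC_complex c x = c * x"

definition cinner_complex :: "complex \<Rightarrow> complex \<Rightarrow> complex"
  where "cinner_complex x y = x * cnj y"

instance
  by standard
    (simp_all add: scaleC_complex_def cinner_complex_def algebra_simps scaleR_conv_of_real
      cmod_def power2_eq_square)

end

text \<open>The norm of an operator \<open>T\<close> restricted to a subspace \<open>V\<close>, for a norm \<open>nrm\<close> on \<open>V\<close>.\<close>

definition opnorm_on :: "'v set \<Rightarrow> ('v \<Rightarrow> real) \<Rightarrow> ('v \<Rightarrow> 'v) \<Rightarrow> real"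
  where "opnorm_on V nrm T = (SUP v\<in>{v \<in> V. nrm v \<le> 1}. nrm (T v))"

text \<open>For a finite set \<open>X\<close>, elements of \<open>l2 X\<close> are represented by functions vanishing off \<open>X\<close>.\<close>

definition l2 :: "'x set \<Rightarrow> ('x \<Rightarrow> complex) set"
  where "l2 X = {f. \<forall>x. x \<notin> X \<longrightarrow> f x = 0}"

definition l2_inner :: "'x set \<Rightarrow> ('x \<Rightarrow> complex) \<Rightarrow> ('x \<Rightarrow> complex) \<Rightarrow> complex"
  where "l2_inner X f h = (\<Sum>x\<in>X. f x * cnj (h x))"

definition l2_norm :: "'x set \<Rightarrow> ('x \<Rightarrow> complex) \<Rightarrow> real"
  where "l2_norm X f = sqrt (\<Sum>x\<in>X. (cmod (f x))\<^sup>2)"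

definition nonprincipal_ultrafilter :: "nat filter \<Rightarrow> bool"
  where "nonprincipal_ultrafilter U \<longleftrightarrow>
    U \<noteq> bot \<and>
    (\<forall>P. eventually P U \<or> eventually (\<lambda>n. \<not> P n) U) \<and>
    (\<forall>m. \<not> eventually (\<lambda>n. n = m) U)"


section \<open>The chain of subgroups and the quasi-regular representations\<close>

text \<open>Indexing starts at \<open>0\<close>: \<open>N 0 \<supset> N 1 \<supset> \<dots>\<close> is the sequence \<open>G\<^sub>1 \<supset> G\<^sub>2 \<supset> \<dots>\<close>.  Consequently
  expressions involving \<open>n - 1\<close> are meaningful for \<open>n \<ge> 1\<close> only.  The value at \<open>n = 0\<close> never
  matters, since it influences neither a limit superior as \<open>n\<close> tends to infinity nor a limit along
  a non-principal ultrafilter.\<close>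

definition normal_chain :: "('a, 'b) monoid_scheme \<Rightarrow> (nat \<Rightarrow> 'a set) \<Rightarrow> bool"
  where "normal_chain G N \<longleftrightarrow>
    (\<forall>n. N n \<lhd> G \<and> finite (carrier (G Mod N n)) \<and> N (Suc n) \<subset> N n) \<and>
    (\<Inter>n. N n) = {\<one>\<^bsub>G\<^esub>}"

definition X :: "('a, 'b) monoid_scheme \<Rightarrow> (nat \<Rightarrow> 'a set) \<Rightarrow> nat \<Rightarrow> 'a set set"
  where "X G N n = carrier (G Mod N n)"

definition \<nu> :: "('a, 'b) monoid_scheme \<Rightarrow> (nat \<Rightarrow> 'a set) \<Rightarrow> nat \<Rightarrow> nat"
  where "\<nu> G N n = card (X G N n)"

definition quasireg ::
  "('a, 'b) monoid_scheme \<Rightarrow> (nat \<Rightarrow> 'a set) \<Rightarrow> nat \<Rightarrow> 'a \<Rightarrow> ('a set \<Rightarrow> complex) \<Rightarrow> 'a set \<Rightarrow> complex"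
  where "quasireg G N n g f =
    (\<lambda>x. if x \<in> X G N n then f ((inv\<^bsub>G\<^esub> g) <#\<^bsub>G\<^esub> x) else 0)"

text \<open>Elements of the complex group algebra are finitely supported functions on the group.\<close>

definition group_algebra :: "('a, 'b) monoid_scheme \<Rightarrow> ('a \<Rightarrow> complex) set"
  where "group_algebra G = {a. {g. a g \<noteq> 0} \<subseteq> carrier G \<and> finite {g. a g \<noteq> 0}}"

definition quasireg_alg ::
  "('a, 'b) monoid_scheme \<Rightarrow> (nat \<Rightarrow> 'a set) \<Rightarrow> nat \<Rightarrow> ('a \<Rightarrow> complex) \<Rightarrow> ('a set \<Rightarrow> complex)
    \<Rightarrow> 'a set \<Rightarrow> complex"
  where "quasireg_alg G N n a f = (\<lambda>x. \<Sum>g | a g \<noteq> 0. a g * quasireg G N n g f x)"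

text \<open>The quotient map from \<open>X G N n\<close> to \<open>X G N (n - 1)\<close> sends the coset \<open>x\<close> to the coset
  \<open>N (n - 1) x\<close>.\<close>

definition quot_map ::
  "('a, 'b) monoid_scheme \<Rightarrow> (nat \<Rightarrow> 'a set) \<Rightarrow> nat \<Rightarrow> 'a set \<Rightarrow> 'a set"
  where "quot_map G N n x = N (n - 1) <#>\<^bsub>G\<^esub> x"

text \<open>\<open>l2_embed G N n\<close> is the isometry from \<open>l2 (X G N (n - 1))\<close> to \<open>l2 (X G N n)\<close>, that is,
  \<open>U\<^sub>n\<^sub>-\<^sub>1\<close> in the usual notation.\<close>

definition l2_embed ::
  "('a, 'b) monoid_scheme \<Rightarrow> (nat \<Rightarrow> 'a set) \<Rightarrow> nat \<Rightarrow> ('a set \<Rightarrow> complex) \<Rightarrow> 'a set \<Rightarrow> complex"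
  where "l2_embed G N n f =
    (\<lambda>x. if x \<in> X G N n
      then complex_of_real (1 / sqrt (real (\<nu> G N n) / real (\<nu> G N (n - 1)))) * f (quot_map G N n x)
      else 0)"

definition \<rho>_space ::
  "('a, 'b) monoid_scheme \<Rightarrow> (nat \<Rightarrow> 'a set) \<Rightarrow> nat \<Rightarrow> ('a set \<Rightarrow> complex) set"
  where "\<rho>_space G N n =
    {f \<in> l2 (X G N n). \<forall>h \<in> l2 (X G N (n - 1)). l2_inner (X G N n) f (l2_embed G N n h) = 0}"

definition \<rho>_norm ::
  "('a, 'b) monoid_scheme \<Rightarrow> (nat \<Rightarrow> 'a set) \<Rightarrow> nat \<Rightarrow> ('a \<Rightarrow> complex) \<Rightarrow> real"
  where "\<rho>_norm G N n a =
    opnorm_on (\<rho>_space G N n) (l2_norm (X G N n)) (quasireg_alg G N n a)"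


section \<open>The ultraproduct representation\<close>

type_synonym 'a vecseq = "nat \<Rightarrow> 'a set \<Rightarrow> complex"

definition Htilde :: "('a, 'b) monoid_scheme \<Rightarrow> (nat \<Rightarrow> 'a set) \<Rightarrow> 'a vecseq set"
  where "Htilde G N =
    {\<xi>. (\<forall>n. \<xi> n \<in> l2 (X G N n)) \<and> bdd_above (range (\<lambda>n. l2_norm (X G N n) (\<xi> n)))}"

definition Hform ::
  "('a, 'b) monoid_scheme \<Rightarrow> (nat \<Rightarrow> 'a set) \<Rightarrow> nat filter \<Rightarrow> 'a vecseq \<Rightarrow> 'a vecseq \<Rightarrow> complex"
  where "Hform G N U \<xi> \<eta> = Lim U (\<lambda>n. l2_inner (X G N n) (\<xi> n) (\<eta> n))"

definition Hnull :: "('a, 'b) monoid_scheme \<Rightarrow> (nat \<Rightarrow> 'a set) \<Rightarrow> nat filter \<Rightarrow> 'a vecseq set"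
  where "Hnull G N U = {\<xi> \<in> Htilde G N. Hform G N U \<xi> \<xi> = 0}"

text \<open>The type \<open>'h\<close> is a Hilbert space completion of \<open>Htilde / Hnull\<close>.  The map
  \<open>\<iota>\<close> is the composition of the quotient map with the inclusion in the completion: being linear and
  compatible with the forms, it has kernel \<open>Hnull\<close> and thus factors through an isometric embedding
  of the quotient.  These conditions determine \<open>('h, \<iota>)\<close> up to a unique unitary isomorphism.\<close>

definition is_completion ::
  "('a, 'b) monoid_scheme \<Rightarrow> (nat \<Rightarrow> 'a set) \<Rightarrow> nat filter \<Rightarrow> ('a vecseq \<Rightarrow> 'h::chilbert_space) \<Rightarrow> bool"
  where "is_completion G N U \<iota> \<longleftrightarrow>
    (\<forall>\<xi>\<in>Htilde G N. \<forall>\<eta>\<in>Htilde G N. \<iota> (\<lambda>n x. \<xi> n x + \<eta> n x) = \<iota> \<xi> + \<iota> \<eta>) \<and>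
    (\<forall>c. \<forall>\<xi>\<in>Htilde G N. \<iota> (\<lambda>n x. c * \<xi> n x) = c *\<^sub>C \<iota> \<xi>) \<and>
    (\<forall>\<xi>\<in>Htilde G N. \<forall>\<eta>\<in>Htilde G N. cinner (\<iota> \<xi>) (\<iota> \<eta>) = Hform G N U \<xi> \<eta>) \<and>
    closure (\<iota> ` Htilde G N) = UNIV"

text \<open>The operator determined on the dense image of \<open>Htilde\<close> by the termwise action, extended by
  continuity.\<close>

definition lam_hat ::
  "('a, 'b) monoid_scheme \<Rightarrow> (nat \<Rightarrow> 'a set) \<Rightarrow> ('a vecseq \<Rightarrow> 'h::chilbert_space) \<Rightarrow> 'a \<Rightarrow> 'h \<Rightarrow> 'h"
  where "lam_hat G N \<iota> g =
    (THE T. continuous_on UNIV T \<and>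
      (\<forall>\<xi>\<in>Htilde G N. T (\<iota> \<xi>) = \<iota> (\<lambda>n. quasireg G N n g (\<xi> n))))"

definition lam_hat_alg ::
  "('a, 'b) monoid_scheme \<Rightarrow> (nat \<Rightarrow> 'a set) \<Rightarrow> ('a vecseq \<Rightarrow> 'h::chilbert_space)
    \<Rightarrow> ('a \<Rightarrow> complex) \<Rightarrow> 'h \<Rightarrow> 'h"
  where "lam_hat_alg G N \<iota> a v = (\<Sum>g | a g \<noteq> 0. a g *\<^sub>C lam_hat G N \<iota> g v)"


section \<open>Growth functions and the associated subrepresentations\<close>

definition growth_functions :: "('a, 'b) monoid_scheme \<Rightarrow> (nat \<Rightarrow> 'a set) \<Rightarrow> (nat \<Rightarrow> nat) set"
  where "growth_functions G N = {\<gamma>. mono \<gamma> \<and> (\<forall>n. 1 \<le> \<gamma> n \<and> \<gamma> n \<le> \<nu> G N n)}"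

definition growth_less :: "nat filter \<Rightarrow> (nat \<Rightarrow> real) \<Rightarrow> (nat \<Rightarrow> real) \<Rightarrow> bool"
  where "growth_less U \<gamma> \<gamma>' \<longleftrightarrow> ((\<lambda>n. \<gamma> n / \<gamma>' n) \<longlongrightarrow> 0) U"

definition Htilde_growth ::
  "('a, 'b) monoid_scheme \<Rightarrow> (nat \<Rightarrow> 'a set) \<Rightarrow> (nat \<Rightarrow> nat) \<Rightarrow> 'a vecseq set"
  where "Htilde_growth G N \<gamma> =
    (\<Union>k\<in>{1..}. {\<xi> \<in> Htilde G N. \<forall>n. card {x \<in> X G N n. \<xi> n x \<noteq> 0} \<le> k * \<gamma> n})"

definition H_growth ::
  "('a, 'b) monoid_scheme \<Rightarrow> (nat \<Rightarrow> 'a set) \<Rightarrow> nat filter \<Rightarrow> ('a vecseq \<Rightarrow> 'h::chilbert_space)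
    \<Rightarrow> (nat \<Rightarrow> nat) \<Rightarrow> 'h set"
  where "H_growth G N U \<iota> \<gamma> =
    closure (\<iota> ` {\<lambda>n x. \<xi> n x + \<zeta> n x | \<xi> \<zeta>. \<xi> \<in> Htilde_growth G N \<gamma> \<and> \<zeta> \<in> Hnull G N U})"

definition \<pi>_norm ::
  "('a, 'b) monoid_scheme \<Rightarrow> (nat \<Rightarrow> 'a set) \<Rightarrow> nat filter \<Rightarrow> ('a vecseq \<Rightarrow> 'h::chilbert_space)
    \<Rightarrow> (nat \<Rightarrow> nat) \<Rightarrow> ('a \<Rightarrow> complex) \<Rightarrow> real"
  where "\<pi>_norm G N U \<iota> \<gamma> a = opnorm_on (H_growth G N U \<iota> \<gamma>) norm (lam_hat_alg G N \<iota> a)"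

end

theory Submission
  imports Defs
begin

text \<open>
  Regarded inside \<open>l2 (X\<^sub>n)\<close>, the space \<open>l2 (X\<^sub>n\<^sub>-\<^sub>1)\<close> consists of the functions that are constant on
  the fibres of \<open>X\<^sub>n \<rightarrow> X\<^sub>n\<^sub>-\<^sub>1\<close>, and the orthogonal projection \<open>P\<^sub>n\<close> onto it averages over these
  fibres.  All fibres have \<open>\<nu>\<^sub>n / \<nu>\<^sub>n\<^sub>-\<^sub>1\<close> points, so averaging a function whose support is small
  compared with this number nearly destroys it: the Cauchy-Schwarz inequality on each fibre gives
  \<open>\<parallel>P\<^sub>n f\<parallel>\<^sup>2 \<le> |supp f| (\<nu>\<^sub>n\<^sub>-\<^sub>1 / \<nu>\<^sub>n) \<parallel>f\<parallel>\<^sup>2\<close> (\<open>fibre_avg_l2_norm_le\<close>).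

  If \<open>\<xi>\<close> is a bounded sequence with \<open>|supp \<xi>\<^sub>n| \<le> k \<gamma>\<^sub>n\<close>, then the growth hypothesis makes \<open>P\<^sub>n \<xi>\<^sub>n\<close>
  tend to \<open>0\<close> along \<open>U\<close>.  The remaining part \<open>\<xi>\<^sub>n - P\<^sub>n \<xi>\<^sub>n\<close> lies in the space of \<open>\<rho>\<^sub>n\<close>, where \<open>a\<close>
  acts with norm \<open>\<parallel>\<rho>\<^sub>n(a)\<parallel>\<close>, and on \<open>P\<^sub>n \<xi>\<^sub>n\<close> the crude bound by the sum of the \<open>|a g|\<close> suffices.
  Hence, for every \<open>c\<close> that bounds \<open>\<parallel>\<rho>\<^sub>n(a)\<parallel>\<close> for all large \<open>n\<close>, passing to the limit along \<open>U\<close> gives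
  \<open>\<parallel>\<pi>\<^sub>\<gamma>(a) \<xi>\<parallel> \<le> c \<parallel>\<xi>\<parallel>\<close> for all these \<open>\<xi>\<close> (\<open>lam_hat_alg_growth_le\<close>), and by continuity on their
  closure \<open>H\<^sub>\<gamma>\<close>.  Every \<open>c\<close> above the limit superior qualifies, because a non-principal
  ultrafilter contains all cofinite sets.

  In the completion, two properties of \<open>\<iota>\<close> translate these finite estimates: the norm of \<open>\<iota> \<xi>\<close> is
  the limit along \<open>U\<close> of the norms of the \<open>\<xi>\<^sub>n\<close> (\<open>tendsto_norm_iota\<close>), and \<open>a\<close> acts termwise on the
  image of \<open>\<iota>\<close> (\<open>lam_hat_alg_iota\<close>).
\<close>


section \<open>Finite-dimensional l2 spaces\<close>

lemma l2_norm_eq_L2_set: "l2_norm A f = L2_set (\<lambda>x. cmod (f x)) A"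
  by (simp add: l2_norm_def L2_set_def)

lemma l2_norm_nonneg [simp]: "l2_norm A f \<ge> 0"
  by (simp add: l2_norm_eq_L2_set)

lemma l2_norm_zero [simp]: "l2_norm A (\<lambda>x. 0) = 0"
  by (simp add: l2_norm_def)

lemma l2_norm_triangle: "l2_norm A (\<lambda>x. f x + h x) \<le> l2_norm A f + l2_norm A h"
proof -
  have "l2_norm A (\<lambda>x. f x + h x) \<le> L2_set (\<lambda>x. cmod (f x) + cmod (h x)) A"
    unfolding l2_norm_eq_L2_set by (rule L2_set_mono) (auto intro: norm_triangle_ineq)
  also have "\<dots> \<le> l2_norm A f + l2_norm A h"
    unfolding l2_norm_eq_L2_set by (rule L2_set_triangle_ineq)
  finally show ?thesis .
qed

lemma l2_norm_scale: "l2_norm A (\<lambda>x. c * f x) = cmod c * l2_norm A f"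
  by (simp add: l2_norm_eq_L2_set norm_mult L2_set_right_distrib)

lemma l2_norm_sum: "l2_norm A (\<lambda>x. \<Sum>i\<in>I. f i x) \<le> (\<Sum>i\<in>I. l2_norm A (f i))"
proof (induction I rule: infinite_finite_induct)
  case (insert i I)
  then show ?case
    using l2_norm_triangle[of A "f i" "\<lambda>x. \<Sum>i\<in>I. f i x"] by simp
qed auto

lemma l2_inner_self: "l2_inner A f f = of_real ((l2_norm A f)\<^sup>2)"
  by (simp add: l2_inner_def l2_norm_def complex_norm_square sum_nonneg flip: of_real_power)


section \<open>Averaging over the fibres of a map\<close>

text \<open>This is the orthogonal projection onto the functions that factor through \<open>q\<close>.\<close>

definition fibre_avg :: "'x set \<Rightarrow> ('x \<Rightarrow> 'y) \<Rightarrow> ('x \<Rightarrow> complex) \<Rightarrow> 'x \<Rightarrow> complex"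
  where "fibre_avg A q f x =
    (if x \<in> A then (\<Sum>y | y \<in> A \<and> q y = q x. f y) / of_nat (card {y \<in> A. q y = q x}) else 0)"

text \<open>Both sides run over the pairs of points of \<open>A\<close> in a common fibre.\<close>

lemma sum_fibre_swap:
  fixes F :: "'x \<Rightarrow> 'x \<Rightarrow> 'c::comm_monoid_add"
  assumes "finite A"
  shows "(\<Sum>x\<in>A. \<Sum>y | y \<in> A \<and> q y = q x. F x y) = (\<Sum>y\<in>A. \<Sum>x | x \<in> A \<and> q x = q y. F x y)"
proof -
  have "(\<Sum>x\<in>A. \<Sum>y | y \<in> A \<and> q y = q x. F x y) = (\<Sum>x\<in>A. \<Sum>y\<in>A. if q y = q x then F x y else 0)"
    using assms by (intro sum.cong refl sum.inter_filter)
  also have "\<dots> = (\<Sum>y\<in>A. \<Sum>x\<in>A. if q y = q x then F x y else 0)"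
    by (rule sum.swap)
  also have "\<dots> = (\<Sum>y\<in>A. \<Sum>x\<in>A. if q x = q y then F x y else 0)"
    by (intro sum.cong refl) auto
  also have "\<dots> = (\<Sum>y\<in>A. \<Sum>x | x \<in> A \<and> q x = q y. F x y)"
    using assms by (intro sum.cong refl sum.inter_filter[symmetric])
  finally show ?thesis .
qed

text \<open>Averaging preserves the sum over each fibre, and \<open>h\<close> can be taken out of that sum.\<close>

lemma fibre_avg_orthogonal:
  assumes "finite A" and h: "\<And>x y. x \<in> A \<Longrightarrow> y \<in> A \<Longrightarrow> q x = q y \<Longrightarrow> h x = h y"
  shows "l2_inner A (\<lambda>x. f x - fibre_avg A q f x) h = 0"
proof -
  let ?c = "\<lambda>x. of_nat (card {y \<in> A. q y = q x}) :: complex"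
  have "l2_inner A (fibre_avg A q f) h
      = (\<Sum>x\<in>A. \<Sum>y | y \<in> A \<and> q y = q x. f y * cnj (h y) / ?c y)"
    unfolding l2_inner_def
  proof (intro sum.cong refl)
    fix x assume x: "x \<in> A"
    have "(\<Sum>y | y \<in> A \<and> q y = q x. f y * cnj (h y) / ?c y)
        = (\<Sum>y | y \<in> A \<and> q y = q x. f y * cnj (h x) / ?c x)"
    proof (intro sum.cong refl)
      fix y assume "y \<in> {y \<in> A. q y = q x}"
      then show "f y * cnj (h y) / ?c y = f y * cnj (h x) / ?c x"
        using h[of y x] x by simp
    qed
    then show "fibre_avg A q f x * cnj (h x) = (\<Sum>y | y \<in> A \<and> q y = q x. f y * cnj (h y) / ?c y)"
      using x by (simp add: fibre_avg_def sum_divide_distrib sum_distrib_right)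
  qed
  also have "\<dots> = (\<Sum>y\<in>A. \<Sum>x | x \<in> A \<and> q x = q y. f y * cnj (h y) / ?c y)"
    by (rule sum_fibre_swap) fact
  also have "\<dots> = l2_inner A f h"
    unfolding l2_inner_def
  proof (intro sum.cong refl)
    fix y assume "y \<in> A"
    then have "card {x \<in> A. q x = q y} \<noteq> 0"
      using assms(1) by auto
    then show "(\<Sum>x | x \<in> A \<and> q x = q y. f y * cnj (h y) / ?c y) = f y * cnj (h y)"
      by simp
  qed
  finally show ?thesis
    by (simp add: l2_inner_def sum_subtractf algebra_simps)
qed

text \<open>A fibre sum has only as many nonzero terms as the support of \<open>f\<close> has points there, so by the
  Cauchy-Schwarz inequality its square is at most that number times the sum of squares.  The
  prefactor \<open>1 / m\<close> of the average enters squared and is recovered once, since each of the \<open>m\<close> points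
  of the fibre carries the same average.\<close>

lemma fibre_avg_l2_norm_le:
  assumes "finite A" and m: "\<And>x. x \<in> A \<Longrightarrow> card {y \<in> A. q y = q x} = m"
  shows "(l2_norm A (fibre_avg A q f))\<^sup>2 \<le> real (card {x \<in> A. f x \<noteq> 0}) / real m * (l2_norm A f)\<^sup>2"
proof -
  define s where "s = card {x \<in> A. f x \<noteq> 0}"
  have sq: "(l2_norm A f)\<^sup>2 = (\<Sum>x\<in>A. (cmod (f x))\<^sup>2)" for f :: "'a \<Rightarrow> complex"
    by (simp add: l2_norm_def sum_nonneg)
  have pt: "(cmod (fibre_avg A q f x))\<^sup>2
      \<le> (\<Sum>y | y \<in> A \<and> q y = q x. real s / (real m)\<^sup>2 * (cmod (f y))\<^sup>2)" if x: "x \<in> A" for x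
  proof -
    let ?F = "{y \<in> A. q y = q x}" and ?S = "{y \<in> A. q y = q x \<and> f y \<noteq> 0}"
    have "cmod (\<Sum>y\<in>?F. f y) = cmod (\<Sum>y\<in>?S. f y)"
      using assms(1) by (intro arg_cong[of _ _ cmod] sum.mono_neutral_right) auto
    also have "\<dots> \<le> (\<Sum>y\<in>?S. cmod (f y))"
      by (rule norm_sum)
    finally have "(cmod (\<Sum>y\<in>?F. f y))\<^sup>2 \<le> (\<Sum>y\<in>?S. cmod (f y))\<^sup>2"
      by (intro power_mono) auto
    also have "\<dots> \<le> (\<Sum>y\<in>?S. (cmod (f y))\<^sup>2) * real (card ?S)"
      by (rule sum_squared_le_sum_of_squares)
    also have "\<dots> \<le> (\<Sum>y\<in>?F. (cmod (f y))\<^sup>2) * real s"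
      unfolding s_def using assms(1)
      by (intro mult_mono sum_mono2 of_nat_mono card_mono sum_nonneg) auto
    finally have "(cmod (\<Sum>y\<in>?F. f y))\<^sup>2 / (real m)\<^sup>2 \<le> (\<Sum>y\<in>?F. (cmod (f y))\<^sup>2) * real s / (real m)\<^sup>2"
      by (rule divide_right_mono) auto
    moreover have "(cmod (fibre_avg A q f x))\<^sup>2 = (cmod (\<Sum>y\<in>?F. f y))\<^sup>2 / (real m)\<^sup>2"
      using x m[OF x] by (simp add: fibre_avg_def norm_divide power_divide)
    ultimately show ?thesis
      by (simp add: sum_distrib_left sum_divide_distrib mult.commute)
  qed
  have "(l2_norm A (fibre_avg A q f))\<^sup>2
      \<le> (\<Sum>x\<in>A. \<Sum>y | y \<in> A \<and> q y = q x. real s / (real m)\<^sup>2 * (cmod (f y))\<^sup>2)"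
    unfolding sq by (intro sum_mono pt)
  also have "\<dots> = (\<Sum>y\<in>A. \<Sum>x | x \<in> A \<and> q x = q y. real s / (real m)\<^sup>2 * (cmod (f y))\<^sup>2)"
    by (rule sum_fibre_swap) fact
  also have "\<dots> = (\<Sum>y\<in>A. real s / real m * (cmod (f y))\<^sup>2)"
    by (intro sum.cong refl) (simp add: m power2_eq_square)
  finally show ?thesis
    unfolding sq s_def by (simp add: sum_distrib_left)
qed


section \<open>The chain of finite quotients\<close>

locale subgroup_chain = group G for G (structure) +
  fixes N :: "nat \<Rightarrow> 'a set"
  assumes normal_chain: "normal_chain G N"
begin

lemma N_normal: "N n \<lhd> G"
  using normal_chain by (simp add: normal_chain_def)

lemma N_subset: "N n \<subseteq> carrier G"
  using normal_imp_subgroup[OF N_normal] by (rule subgroup.subset)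

lemma N_decreasing: "N n \<subseteq> N (n - 1)"
  using normal_chain by (cases n) (auto simp: normal_chain_def)

lemma finite_X: "finite (X G N n)"
  using normal_chain by (simp add: normal_chain_def X_def)

lemma X_altdef: "X G N n = (\<lambda>h. N n #> h) ` carrier G"
  by (auto simp: X_def FactGroup_def RCOSETS_def)

lemma translate_coset:
  assumes "g \<in> carrier G" "h \<in> carrier G"
  shows "g <#\<^bsub>G\<^esub> (N n #> h) = N n #> (g \<otimes> h)"
proof -
  have "N n #> x = x <#\<^bsub>G\<^esub> N n" if "x \<in> carrier G" for x
    using normal.coset_eq[OF N_normal] that by blast
  then show ?thesis
    using assms lcos_m_assoc[OF N_subset assms] by simp
qed

lemma quot_map_coset:
  assumes "h \<in> carrier G"
  shows "quot_map G N n (N n #> h) = N (n - 1) #> h"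
proof -
  let ?M = "N (n - 1)"
  have sub: "subgroup ?M G" "subgroup (N n) G"
    using N_normal normal_imp_subgroup by auto
  have "?M <#> N n \<subseteq> ?M <#> ?M"
    using N_decreasing by (auto simp: set_mult_def)
  moreover have "?M <#> ?M = ?M"
    using subgroup_mult_id[OF sub(1)] .
  moreover have "?M \<subseteq> ?M <#> N n"
  proof
    fix x assume x: "x \<in> ?M"
    then have "x = x \<otimes> \<one>" "\<one> \<in> N n"
      using subsetD[OF N_subset x] subgroup.one_closed[OF sub(2)] by simp_all
    then show "x \<in> ?M <#> N n"
      using x unfolding set_mult_def by blast
  qed
  ultimately have "?M <#> N n = ?M"
    by blast
  then show ?thesis
    unfolding quot_map_def using setmult_rcos_assoc[OF N_subset N_subset assms] by simp
qed

lemma translate_in_X: "g \<in> carrier G \<Longrightarrow> x \<in> X G N n \<Longrightarrow> g <#\<^bsub>G\<^esub> x \<in> X G N n"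
  by (auto simp: X_altdef translate_coset)

lemma translate_translate_inv: "g \<in> carrier G \<Longrightarrow> x \<in> X G N n \<Longrightarrow> g <#\<^bsub>G\<^esub> (inv g <#\<^bsub>G\<^esub> x) = x"
  by (auto simp: X_altdef translate_coset m_assoc[symmetric])

lemma translate_inv_translate: "g \<in> carrier G \<Longrightarrow> x \<in> X G N n \<Longrightarrow> inv g <#\<^bsub>G\<^esub> (g <#\<^bsub>G\<^esub> x) = x"
  by (auto simp: X_altdef translate_coset m_assoc[symmetric])

lemma quot_map_in_X: "x \<in> X G N n \<Longrightarrow> quot_map G N n x \<in> X G N (n - 1)"
  by (auto simp: X_altdef quot_map_coset)

lemma quot_map_translate:
  "g \<in> carrier G \<Longrightarrow> x \<in> X G N n \<Longrightarrow> quot_map G N n (g <#\<^bsub>G\<^esub> x) = g <#\<^bsub>G\<^esub> quot_map G N n x"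
  by (auto simp: X_altdef quot_map_coset translate_coset)

text \<open>Translation by \<open>g\<close> commutes with the quotient map, hence it carries the fibre over \<open>z\<close>
  injectively into the fibre over \<open>g z\<close>; and \<open>G\<close> acts transitively on the quotient.\<close>

lemma card_fibre_le:
  assumes "z \<in> X G N (n - 1)" "w \<in> X G N (n - 1)"
  shows "card {y \<in> X G N n. quot_map G N n y = z} \<le> card {y \<in> X G N n. quot_map G N n y = w}"
proof -
  obtain h k where hk: "h \<in> carrier G" "k \<in> carrier G" "z = N (n - 1) #> h" "w = N (n - 1) #> k"
    using assms by (auto simp: X_altdef)
  define g where "g = k \<otimes> inv h"
  have g: "g \<in> carrier G" "g <#\<^bsub>G\<^esub> z = w"
    using hk by (auto simp: g_def translate_coset m_assoc)
  show ?thesis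
  proof (rule card_inj_on_le)
    show "inj_on (\<lambda>x. g <#\<^bsub>G\<^esub> x) {y \<in> X G N n. quot_map G N n y = z}"
      by (rule inj_on_inverseI[where g = "\<lambda>x. inv g <#\<^bsub>G\<^esub> x"]) (auto simp: translate_inv_translate g)
  qed (use g in \<open>auto simp: translate_in_X quot_map_translate finite_X\<close>)
qed

lemma nu_pos: "\<nu> G N n > 0"
  unfolding \<nu>_def card_gt_0_iff using finite_X by (auto simp: X_altdef)

lemma card_fibre:
  assumes "x \<in> X G N n"
  shows "real (card {y \<in> X G N n. quot_map G N n y = quot_map G N n x})
    = real (\<nu> G N n) / real (\<nu> G N (n - 1))"
proof -
  let ?c = "\<lambda>z. card {y \<in> X G N n. quot_map G N n y = z}"
  have eq: "?c z = ?c (quot_map G N n x)" if "z \<in> X G N (n - 1)" for z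
    using card_fibre_le[of z n] card_fibre_le[of _ n z] that quot_map_in_X[OF assms] by (simp add: le_antisym)
  have "\<nu> G N n = (\<Sum>z\<in>X G N (n - 1). ?c z)"
    unfolding \<nu>_def card_eq_sum
    by (rule sum.group[symmetric]) (use finite_X quot_map_in_X in auto)
  also have "\<dots> = \<nu> G N (n - 1) * ?c (quot_map G N n x)"
    using eq by (simp add: \<nu>_def)
  finally show ?thesis
    using nu_pos[of "n - 1"] by simp
qed

lemma quasireg_in_l2: "quasireg G N n g f \<in> l2 (X G N n)"
  by (simp add: l2_def quasireg_def)

lemma l2_norm_quasireg:
  assumes "g \<in> carrier G"
  shows "l2_norm (X G N n) (quasireg G N n g f) = l2_norm (X G N n) f"
proof -
  have "bij_betw (\<lambda>x. inv g <#\<^bsub>G\<^esub> x) (X G N n) (X G N n)"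
    by (rule bij_betw_byWitness[where f' = "\<lambda>x. g <#\<^bsub>G\<^esub> x"])
      (auto simp: assms translate_in_X translate_translate_inv translate_inv_translate)
  from sum.reindex_bij_betw[OF this, of "\<lambda>x. (cmod (f x))\<^sup>2"] show ?thesis
    by (simp add: l2_norm_def quasireg_def)
qed

text \<open>Each group element acts isometrically, so the triangle inequality bounds the operator norm
  by the sum of the absolute values of the coefficients of \<open>a\<close>.\<close>

lemma l2_norm_quasireg_alg_le:
  assumes "a \<in> group_algebra G"
  shows "l2_norm (X G N n) (quasireg_alg G N n a f)
    \<le> (\<Sum>g | a g \<noteq> 0. cmod (a g)) * l2_norm (X G N n) f"
proof -
  have "l2_norm (X G N n) (quasireg_alg G N n a f)
      \<le> (\<Sum>g | a g \<noteq> 0. l2_norm (X G N n) (\<lambda>x. a g * quasireg G N n g f x))"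
    unfolding quasireg_alg_def by (rule l2_norm_sum)
  also have "\<dots> = (\<Sum>g | a g \<noteq> 0. cmod (a g) * l2_norm (X G N n) f)"
    using assms by (intro sum.cong refl) (auto simp: l2_norm_scale l2_norm_quasireg group_algebra_def)
  finally show ?thesis
    by (simp add: sum_distrib_right)
qed

lemma quasireg_alg_add:
  "quasireg_alg G N n a (\<lambda>x. f x + h x) = (\<lambda>x. quasireg_alg G N n a f x + quasireg_alg G N n a h x)"
  by (auto simp: quasireg_alg_def quasireg_def fun_eq_iff algebra_simps simp flip: sum.distrib
      intro!: sum.cong)

lemma quasireg_alg_scale:
  "quasireg_alg G N n a (\<lambda>x. c * f x) = (\<lambda>x. c * quasireg_alg G N n a f x)"
  by (auto simp: quasireg_alg_def quasireg_def fun_eq_iff sum_distrib_left intro!: sum.cong)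

text \<open>A supremum of an unbounded set of reals has an unspecified value, so boundedness is what makes
  \<open>\<rho>_norm\<close> an actual operator norm.\<close>

lemma bdd_above_rho_norm:
  assumes a: "a \<in> group_algebra G"
  shows "bdd_above ((\<lambda>v. l2_norm (X G N n) (quasireg_alg G N n a v))
    ` {v \<in> \<rho>_space G N n. l2_norm (X G N n) v \<le> 1})"
proof (rule bdd_aboveI2)
  fix v assume "v \<in> {v \<in> \<rho>_space G N n. l2_norm (X G N n) v \<le> 1}"
  then show "l2_norm (X G N n) (quasireg_alg G N n a v) \<le> (\<Sum>g | a g \<noteq> 0. cmod (a g)) * 1"
    by (intro order_trans[OF l2_norm_quasireg_alg_le[OF a]] mult_left_mono sum_nonneg) auto
qed

lemma rho_norm_bound:
  assumes a: "a \<in> group_algebra G" and f: "f \<in> \<rho>_space G N n"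
  shows "l2_norm (X G N n) (quasireg_alg G N n a f) \<le> \<rho>_norm G N n a * l2_norm (X G N n) f"
proof (cases "l2_norm (X G N n) f = 0")
  case True
  then show ?thesis
    using l2_norm_quasireg_alg_le[OF a, of n f] by simp
next
  case False
  define r where "r = l2_norm (X G N n) f"
  have r: "r > 0"
    using False by (simp add: r_def order_less_le)
  define h where "h = (\<lambda>x. complex_of_real (1 / r) * f x)"
  have h: "h \<in> {v \<in> \<rho>_space G N n. l2_norm (X G N n) v \<le> 1}"
  proof -
    have "l2_inner (X G N n) h k = complex_of_real (1 / r) * l2_inner (X G N n) f k" for k
      by (simp add: l2_inner_def h_def sum_distrib_left mult.assoc)
    then have "h \<in> \<rho>_space G N n"
      using f by (simp add: \<rho>_space_def l2_def h_def)
    moreover have "l2_norm (X G N n) h = 1"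
      unfolding h_def l2_norm_scale r_def[symmetric] norm_of_real using r by simp
    ultimately show ?thesis
      by simp
  qed
  from cSUP_upper[OF h bdd_above_rho_norm[OF a]]
  have "l2_norm (X G N n) (quasireg_alg G N n a h) \<le> \<rho>_norm G N n a"
    unfolding \<rho>_norm_def opnorm_on_def .
  moreover have "l2_norm (X G N n) (quasireg_alg G N n a h)
      = l2_norm (X G N n) (quasireg_alg G N n a f) / r"
    unfolding h_def quasireg_alg_scale l2_norm_scale norm_of_real using r by simp
  ultimately show ?thesis
    using r by (simp add: r_def[symmetric] field_simps)
qed

lemma zero_in_rho_space: "(\<lambda>x. 0) \<in> \<rho>_space G N n"
  by (simp add: \<rho>_space_def l2_def l2_inner_def)

text \<open>Embedded functions are constant on the fibres of the quotient map.\<close>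

lemma minus_fibre_avg_in_rho_space:
  assumes "f \<in> l2 (X G N n)"
  shows "(\<lambda>x. f x - fibre_avg (X G N n) (quot_map G N n) f x) \<in> \<rho>_space G N n"
proof -
  have "l2_inner (X G N n) (\<lambda>x. f x - fibre_avg (X G N n) (quot_map G N n) f x) (l2_embed G N n h) = 0" for h
    by (rule fibre_avg_orthogonal) (auto simp: finite_X l2_embed_def)
  then show ?thesis
    using assms by (simp add: \<rho>_space_def l2_def fibre_avg_def)
qed

text \<open>The finite-level estimate.  Write \<open>f = d + p\<close> with \<open>p\<close> the fibre average.  Then \<open>a\<close> acts on \<open>d\<close> with
  norm at most \<open>c\<close>, on \<open>p\<close> with norm at most the sum of the \<open>|a g|\<close>, and \<open>p\<close> is small if the support
  of \<open>f\<close> is.  The bound \<open>\<parallel>d\<parallel> \<le> \<parallel>f\<parallel> + \<parallel>p\<parallel>\<close> is good enough because \<open>\<parallel>p\<parallel>\<close> vanishes in the limit; this is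
  where the second \<open>c\<close> comes from.\<close>

lemma quasireg_alg_small_support_le:
  assumes a: "a \<in> group_algebra G" and f: "f \<in> l2 (X G N n)"
    and c: "\<rho>_norm G N n a \<le> c" "c \<ge> 0"
  shows "l2_norm (X G N n) (quasireg_alg G N n a f)
    \<le> (c + (c + (\<Sum>g | a g \<noteq> 0. cmod (a g))) *
        sqrt (real (card {x \<in> X G N n. f x \<noteq> 0}) / (real (\<nu> G N n) / real (\<nu> G N (n - 1)))))
      * l2_norm (X G N n) f"
proof -
  let ?nm = "l2_norm (X G N n)" and ?T = "quasireg_alg G N n a"
  define K where "K = (\<Sum>g | a g \<noteq> 0. cmod (a g))"
  define s where "s = real (card {x \<in> X G N n. f x \<noteq> 0}) / (real (\<nu> G N n) / real (\<nu> G N (n - 1)))"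
  define p where "p = fibre_avg (X G N n) (quot_map G N n) f"
  define d where "d = (\<lambda>x. f x - p x)"
  have K: "K \<ge> 0"
    unfolding K_def by (intro sum_nonneg) auto
  obtain m where m: "real m = real (\<nu> G N n) / real (\<nu> G N (n - 1))"
    "\<And>x. x \<in> X G N n \<Longrightarrow> card {y \<in> X G N n. quot_map G N n y = quot_map G N n x} = m"
  proof -
    obtain x where x: "x \<in> X G N n"
      using nu_pos[of n] unfolding \<nu>_def by fastforce
    show thesis
    proof (rule that[OF card_fibre[OF x]])
      fix y assume "y \<in> X G N n"
      then show "card {z \<in> X G N n. quot_map G N n z = quot_map G N n y}
          = card {y \<in> X G N n. quot_map G N n y = quot_map G N n x}"
        using card_fibre[of y n] card_fibre[OF x] by linarith
    qed
  qed
  have "(?nm p)\<^sup>2 \<le> s * (?nm f)\<^sup>2"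
    unfolding p_def s_def m(1)[symmetric] by (rule fibre_avg_l2_norm_le) (auto simp: finite_X m(2))
  then have p: "?nm p \<le> sqrt s * ?nm f"
    using real_le_rsqrt[of "?nm p" "s * (?nm f)\<^sup>2"] by (simp add: real_sqrt_mult)
  have "?nm d \<le> ?nm f + ?nm p"
    using l2_norm_triangle[of _ f "\<lambda>x. (-1) * p x"] unfolding l2_norm_scale d_def by simp
  have "f = (\<lambda>x. d x + p x)"
    by (simp add: d_def)
  then have "?nm (?T f) \<le> ?nm (?T d) + ?nm (?T p)"
    using quasireg_alg_add[of n a d p] l2_norm_triangle by simp
  also have "?nm (?T d) \<le> c * (?nm f + ?nm p)"
  proof -
    have "?nm (?T d) \<le> \<rho>_norm G N n a * ?nm d"
      using minus_fibre_avg_in_rho_space[OF f] unfolding d_def p_def by (rule rho_norm_bound[OF a])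
    also have "\<dots> \<le> c * (?nm f + ?nm p)"
      using c \<open>?nm d \<le> ?nm f + ?nm p\<close> by (intro mult_mono) auto
    finally show ?thesis .
  qed
  also have "?nm (?T p) \<le> K * ?nm p"
    unfolding K_def by (rule l2_norm_quasireg_alg_le[OF a])
  also have "c * (?nm f + ?nm p) + K * ?nm p = c * ?nm f + (c + K) * ?nm p"
    by (simp add: algebra_simps)
  also have "\<dots> \<le> c * ?nm f + (c + K) * (sqrt s * ?nm f)"
    using c K p by (intro add_left_mono mult_left_mono) auto
  finally show ?thesis
    by (simp add: K_def s_def algebra_simps)
qed

lemma rho_norm_nonneg:
  assumes a: "a \<in> group_algebra G"
  shows "\<rho>_norm G N n a \<ge> 0"
proof -
  have "0 \<le> l2_norm (X G N n) (quasireg_alg G N n a (\<lambda>x. 0))"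
    by simp
  also have "\<dots> \<le> \<rho>_norm G N n a"
    unfolding \<rho>_norm_def opnorm_on_def
    by (rule cSUP_upper[OF _ bdd_above_rho_norm[OF a]]) (simp add: zero_in_rho_space)
  finally show ?thesis .
qed

end


section \<open>Complex Hilbert spaces and limits along ultrafilters\<close>

lemma norm_scaleC: "norm (c *\<^sub>C x) = cmod c * norm (x :: 'h::chilbert_space)"
proof -
  have "cinner (c *\<^sub>C x) (c *\<^sub>C x) = c * cnj c * cinner x x"
    using cinner_commute[of x "c *\<^sub>C x"] cinner_commute[of x x] by (simp add: cinner_scaleC_left)
  also have "c * cnj c = complex_of_real ((cmod c)\<^sup>2)"
    by (rule complex_norm_square[symmetric])
  finally have "Re (cinner (c *\<^sub>C x) (c *\<^sub>C x)) = (cmod c)\<^sup>2 * Re (cinner x x)"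
    by simp
  then show ?thesis
    by (simp add: norm_eq_sqrt_cinner[where 'a = 'h] real_sqrt_mult)
qed

lemma bounded_linear_scaleC: "bounded_linear (\<lambda>x :: 'h::chilbert_space. c *\<^sub>C x)"
proof (rule bounded_linear_intro[where K = "cmod c"])
  fix r and x :: 'h
  show "c *\<^sub>C (r *\<^sub>R x) = r *\<^sub>R (c *\<^sub>C x)"
    by (simp add: scaleR_scaleC scaleC_scaleC mult.commute)
qed (simp_all add: scaleC_add_right norm_scaleC mult.commute)

lemma minus_eq_scaleC: "- x = (-1) *\<^sub>C (x :: 'h::chilbert_space)"
  using scaleR_scaleC[of "-1" x] by simp

lemma nonprincipal_ultrafilter_le_sequentially:
  assumes "nonprincipal_ultrafilter U"
  shows "U \<le> sequentially"
proof (rule filter_leI)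
  fix P assume "eventually P sequentially"
  then obtain M where M: "\<And>n. n \<ge> M \<Longrightarrow> P n"
    by (auto simp: eventually_sequentially)
  have "eventually (\<lambda>n. n \<noteq> m) U" for m
    using assms unfolding nonprincipal_ultrafilter_def by blast
  then have "eventually (\<lambda>n. \<forall>m\<in>{..<M}. n \<noteq> m) U"
    by (intro eventually_ball_finite) auto
  then show "eventually P U"
  proof (rule eventually_mono)
    fix n assume "\<forall>m\<in>{..<M}. n \<noteq> m"
    then have "\<not> n < M"
      by blast
    then show "P n"
      using M[of n] by simp
  qed
qed

text \<open>Compactness provides a cluster point \<open>l\<close> of the image filter.  A neighbourhood of \<open>l\<close> whose
  preimage is not in the ultrafilter would have the complement of that preimage in it, which
  contradicts clustering.\<close>

lemma ultrafilter_bounded_convergent: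
  fixes f :: "nat \<Rightarrow> 'b::heine_borel"
  assumes U: "nonprincipal_ultrafilter U" and "bounded (range f)"
  obtains l where "(f \<longlongrightarrow> l) U"
proof -
  have "compact (closure (range f))"
    using assms(2) by simp
  moreover have "filtermap f U \<noteq> bot"
    using U by (simp add: nonprincipal_ultrafilter_def filtermap_bot_iff)
  moreover have "f n \<in> closure (range f)" for n
    by (rule subsetD[OF closure_subset]) simp
  then have "eventually (\<lambda>x. x \<in> closure (range f)) (filtermap f U)"
    by (simp add: eventually_filtermap)
  ultimately have "\<exists>l\<in>closure (range f). inf (nhds l) (filtermap f U) \<noteq> bot"
    by (rule compact_filter[THEN iffD1, rule_format])
  then obtain l where l: "inf (nhds l) (filtermap f U) \<noteq> bot" ..
  have "(f \<longlongrightarrow> l) U"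
  proof (rule topological_tendstoI, rule ccontr)
    fix S assume S: "open S" "l \<in> S" "\<not> eventually (\<lambda>n. f n \<in> S) U"
    then have "eventually (\<lambda>n. f n \<notin> S) U"
      using U unfolding nonprincipal_ultrafilter_def by blast
    then have "eventually (\<lambda>x. x \<notin> S) (filtermap f U)"
      by (simp add: eventually_filtermap)
    moreover have "eventually (\<lambda>x. x \<in> S) (nhds l)"
      using S by (intro eventually_nhds_in_open)
    ultimately have "eventually (\<lambda>x. False) (inf (nhds l) (filtermap f U))"
      unfolding eventually_inf by blast
    then show False
      using l by (simp add: trivial_limit_def)
  qed
  then show thesis
    by (rule that)
qed


section \<open>The ultraproduct representation\<close>

locale ultraproduct = subgroup_chain G N for G (structure) and N :: "nat \<Rightarrow> 'a set" +
  fixes U :: "nat filter" and \<iota> :: "'a vecseq \<Rightarrow> 'h::chilbert_space"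
  assumes ultra: "nonprincipal_ultrafilter U"
    and completion: "is_completion G N U \<iota>"
begin

lemma U_nontrivial: "U \<noteq> bot"
  using ultra by (simp add: nonprincipal_ultrafilter_def)

lemma HtildeI:
  assumes "\<And>n. \<xi> n \<in> l2 (X G N n)" "\<And>n. l2_norm (X G N n) (\<xi> n) \<le> C"
  shows "\<xi> \<in> Htilde G N"
  using assms by (auto simp: Htilde_def intro!: bdd_aboveI2[where M = C])

lemma HtildeE:
  assumes "\<xi> \<in> Htilde G N"
  obtains C where "\<And>n. l2_norm (X G N n) (\<xi> n) \<le> C"
  using assms unfolding Htilde_def bdd_above_def by auto

lemma Htilde_l2: "\<xi> \<in> Htilde G N \<Longrightarrow> \<xi> n \<in> l2 (X G N n)"
  by (simp add: Htilde_def)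

lemma Htilde_zero: "(\<lambda>n x. 0) \<in> Htilde G N"
  by (rule HtildeI[where C = 0]) (auto simp: l2_def)

lemma Htilde_add:
  assumes "\<xi> \<in> Htilde G N" "\<eta> \<in> Htilde G N"
  shows "(\<lambda>n x. \<xi> n x + \<eta> n x) \<in> Htilde G N"
proof -
  obtain C D where "\<And>n. l2_norm (X G N n) (\<xi> n) \<le> C" "\<And>n. l2_norm (X G N n) (\<eta> n) \<le> D"
    using assms by (metis HtildeE)
  then show ?thesis
    using Htilde_l2[OF assms(1)] Htilde_l2[OF assms(2)]
    by (intro HtildeI[where C = "C + D"] order_trans[OF l2_norm_triangle] add_mono) (auto simp: l2_def)
qed

lemma Htilde_scale:
  assumes "\<xi> \<in> Htilde G N"
  shows "(\<lambda>n x. c * \<xi> n x) \<in> Htilde G N"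
proof -
  obtain C where "\<And>n. l2_norm (X G N n) (\<xi> n) \<le> C"
    using assms by (metis HtildeE)
  then show ?thesis
    using Htilde_l2[OF assms]
    by (intro HtildeI[where C = "cmod c * C"]) (auto simp: l2_def l2_norm_scale intro: mult_left_mono)
qed

lemma Htilde_quasireg:
  assumes "\<xi> \<in> Htilde G N" "g \<in> carrier G"
  shows "(\<lambda>n. quasireg G N n g (\<xi> n)) \<in> Htilde G N"
proof -
  obtain C where "\<And>n. l2_norm (X G N n) (\<xi> n) \<le> C"
    using assms(1) by (metis HtildeE)
  then show ?thesis
    by (intro HtildeI[where C = C]) (simp_all add: quasireg_in_l2 l2_norm_quasireg assms(2))
qed

lemma iota_add:
  "\<xi> \<in> Htilde G N \<Longrightarrow> \<eta> \<in> Htilde G N \<Longrightarrow> \<iota> (\<lambda>n x. \<xi> n x + \<eta> n x) = \<iota> \<xi> + \<iota> \<eta>"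
  using completion unfolding is_completion_def by blast

lemma iota_scale: "\<xi> \<in> Htilde G N \<Longrightarrow> \<iota> (\<lambda>n x. c * \<xi> n x) = c *\<^sub>C \<iota> \<xi>"
  using completion unfolding is_completion_def by blast

lemma cinner_iota:
  "\<xi> \<in> Htilde G N \<Longrightarrow> \<eta> \<in> Htilde G N \<Longrightarrow> cinner (\<iota> \<xi>) (\<iota> \<eta>) = Hform G N U \<xi> \<eta>"
  using completion unfolding is_completion_def by blast

lemma iota_zero: "\<iota> (\<lambda>n x. 0) = 0"
  using iota_add[OF Htilde_zero Htilde_zero] by simp

lemma iota_diff:
  assumes "\<xi> \<in> Htilde G N" "\<eta> \<in> Htilde G N"
  shows "\<iota> \<xi> - \<iota> \<eta> = \<iota> (\<lambda>n x. \<xi> n x + (-1) * \<eta> n x)"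
  unfolding iota_add[OF assms(1) Htilde_scale[OF assms(2)]] iota_scale[OF assms(2)]
  by (simp flip: minus_eq_scaleC)

lemma iota_sum:
  assumes "finite I" "\<And>i. i \<in> I \<Longrightarrow> \<eta> i \<in> Htilde G N"
  shows "(\<lambda>n x. \<Sum>i\<in>I. \<eta> i n x) \<in> Htilde G N \<and> \<iota> (\<lambda>n x. \<Sum>i\<in>I. \<eta> i n x) = (\<Sum>i\<in>I. \<iota> (\<eta> i))"
  using assms
proof (induction I)
  case empty
  then show ?case
    by (simp add: Htilde_zero iota_zero)
next
  case (insert i I)
  then show ?case
    using iota_add[of "\<eta> i" "\<lambda>n x. \<Sum>i\<in>I. \<eta> i n x"] Htilde_add[of "\<eta> i" "\<lambda>n x. \<Sum>i\<in>I. \<eta> i n x"]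
    by simp
qed

lemma dense_iota: "closure (\<iota> ` Htilde G N) = UNIV"
  using completion unfolding is_completion_def by blast

text \<open>The form is a limit along \<open>U\<close> chosen by \<open>Lim\<close>, whose value means something only once the limit
  is known to exist.\<close>

lemma tendsto_norm_iota:
  assumes "\<xi> \<in> Htilde G N"
  shows "((\<lambda>n. l2_norm (X G N n) (\<xi> n)) \<longlongrightarrow> norm (\<iota> \<xi>)) U"
proof -
  let ?f = "\<lambda>n. l2_inner (X G N n) (\<xi> n) (\<xi> n)"
  obtain C where C: "\<And>n. l2_norm (X G N n) (\<xi> n) \<le> C"
    using assms by (metis HtildeE)
  have "bounded (range ?f)"
    unfolding bounded_iff
  proof (intro exI[of _ "C\<^sup>2"] ballI)
    fix z assume "z \<in> range ?f"
    then show "norm z \<le> C\<^sup>2"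
      using C by (auto simp: l2_inner_self norm_power intro!: power_mono)
  qed
  then obtain l where l: "(?f \<longlongrightarrow> l) U"
    using ultrafilter_bounded_convergent[OF ultra] by blast
  then have "Hform G N U \<xi> \<xi> = l"
    unfolding Hform_def by (rule tendsto_Lim[OF U_nontrivial])
  then have "cinner (\<iota> \<xi>) (\<iota> \<xi>) = l"
    by (simp add: cinner_iota assms)
  then have "norm (\<iota> \<xi>) = sqrt (Re l)"
    by (simp add: norm_eq_sqrt_cinner)
  moreover have "((\<lambda>n. sqrt (Re (?f n))) \<longlongrightarrow> sqrt (Re l)) U"
    using l by (intro tendsto_intros)
  ultimately show ?thesis
    by (simp add: l2_inner_self)
qed

lemma norm_iota_quasireg:
  assumes "\<xi> \<in> Htilde G N" "g \<in> carrier G"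
  shows "norm (\<iota> (\<lambda>n. quasireg G N n g (\<xi> n))) = norm (\<iota> \<xi>)"
  using tendsto_norm_iota[OF Htilde_quasireg[OF assms]]
  unfolding l2_norm_quasireg[OF assms(2)]
  by (rule tendsto_unique[OF U_nontrivial _ tendsto_norm_iota[OF assms(1)]])

text \<open>The termwise action preserves distances between vectors \<open>\<iota> \<xi>\<close>.  It is therefore well defined on
  the image of \<open>\<iota>\<close> and uniformly continuous there, and extends to the closure, which is the whole
  space; two continuous extensions agree on a dense set.  So the definite description in the
  definition of \<open>lam_hat\<close> is proper.\<close>

lemma lam_hat:
  assumes g: "g \<in> carrier G"
  shows "continuous_on UNIV (lam_hat G N \<iota> g) \<and>
    (\<forall>\<xi>\<in>Htilde G N. lam_hat G N \<iota> g (\<iota> \<xi>) = \<iota> (\<lambda>n. quasireg G N n g (\<xi> n)))"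
proof -
  let ?L = "\<lambda>\<xi> n. quasireg G N n g (\<xi> n)"
  \<comment> \<open>An arbitrary choice of preimages; \<open>dist\<close> with equal arguments makes it immaterial.\<close>
  define f where "f v = \<iota> (?L (inv_into (Htilde G N) \<iota> v))" for v
  have dist: "dist (\<iota> (?L \<xi>)) (\<iota> (?L \<eta>)) = dist (\<iota> \<xi>) (\<iota> \<eta>)"
    if "\<xi> \<in> Htilde G N" "\<eta> \<in> Htilde G N" for \<xi> \<eta>
  proof -
    have eq: "(\<lambda>n x. ?L \<xi> n x + (-1) * ?L \<eta> n x) = ?L (\<lambda>n x. \<xi> n x + (-1) * \<eta> n x)"
      by (auto simp: quasireg_def fun_eq_iff)
    have "dist (\<iota> (?L \<xi>)) (\<iota> (?L \<eta>)) = norm (\<iota> (?L (\<lambda>n x. \<xi> n x + (-1) * \<eta> n x)))"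
      unfolding dist_norm iota_diff[OF Htilde_quasireg[OF that(1) g] Htilde_quasireg[OF that(2) g]] eq ..
    also have "\<dots> = norm (\<iota> (\<lambda>n x. \<xi> n x + (-1) * \<eta> n x))"
      by (rule norm_iota_quasireg[OF Htilde_add[OF that(1) Htilde_scale[OF that(2)]] g])
    also have "\<dots> = dist (\<iota> \<xi>) (\<iota> \<eta>)"
      unfolding dist_norm iota_diff[OF that] ..
    finally show ?thesis .
  qed
  have f_iota: "f (\<iota> \<xi>) = \<iota> (?L \<xi>)" if "\<xi> \<in> Htilde G N" for \<xi>
  proof -
    have "inv_into (Htilde G N) \<iota> (\<iota> \<xi>) \<in> Htilde G N" "\<iota> (inv_into (Htilde G N) \<iota> (\<iota> \<xi>)) = \<iota> \<xi>"
      using that inv_into_into[of "\<iota> \<xi>" \<iota> "Htilde G N"] f_inv_into_f[of "\<iota> \<xi>" \<iota> "Htilde G N"] by simp_all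
    then show ?thesis
      using dist[of "inv_into (Htilde G N) \<iota> (\<iota> \<xi>)" \<xi>] that by (simp add: f_def)
  qed
  have uc: "uniformly_continuous_on (\<iota> ` Htilde G N) f"
    unfolding uniformly_continuous_on_def
  proof (intro allI impI)
    fix e :: real assume e: "e > 0"
    have "dist (f w) (f v) = dist w v" if "v \<in> \<iota> ` Htilde G N" "w \<in> \<iota> ` Htilde G N" for v w
      using that by (auto simp: f_iota dist)
    then show "\<exists>d>0. \<forall>v\<in>\<iota> ` Htilde G N. \<forall>w\<in>\<iota> ` Htilde G N. dist w v < d \<longrightarrow> dist (f w) (f v) < e"
      using e by (intro exI[of _ e]) simp
  qed
  obtain T where T: "uniformly_continuous_on UNIV T" "\<forall>v\<in>\<iota> ` Htilde G N. f v = T v"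
    by (rule uniformly_continuous_on_extension_on_closure[OF uc, unfolded dense_iota]) (rule that, assumption, simp)
  have T_iota: "T (\<iota> \<xi>) = \<iota> (?L \<xi>)" if "\<xi> \<in> Htilde G N" for \<xi>
    using T(2) f_iota that by simp
  have cont: "continuous_on UNIV T"
    by (rule uniformly_continuous_imp_continuous[OF T(1)])
  show ?thesis
    unfolding lam_hat_def
  proof (rule theI[where a = T])
    show "continuous_on UNIV T \<and> (\<forall>\<xi>\<in>Htilde G N. T (\<iota> \<xi>) = \<iota> (?L \<xi>))"
      using cont T_iota by simp
  next
    fix S assume S: "continuous_on UNIV S \<and> (\<forall>\<xi>\<in>Htilde G N. S (\<iota> \<xi>) = \<iota> (?L \<xi>))"
    have "closure (\<iota> ` Htilde G N) \<subseteq> {v. S v = T v}"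
      using S cont T_iota by (intro closure_minimal closed_Collect_eq) auto
    then show "S = T"
      unfolding dense_iota by auto
  qed
qed

lemma continuous_lam_hat_alg:
  assumes "a \<in> group_algebra G"
  shows "continuous_on UNIV (lam_hat_alg G N \<iota> a)"
proof -
  have "continuous_on UNIV (\<lambda>v. a g *\<^sub>C lam_hat G N \<iota> g v)" if "a g \<noteq> 0" for g
    using that assms lam_hat[of g]
    by (intro bounded_linear.continuous_on[OF bounded_linear_scaleC]) (auto simp: group_algebra_def)
  then have "continuous_on UNIV (\<lambda>v. \<Sum>g | a g \<noteq> 0. a g *\<^sub>C lam_hat G N \<iota> g v)"
    by (intro continuous_on_sum) auto
  then show ?thesis
    by (simp add: lam_hat_alg_def[abs_def])
qed

lemma lam_hat_alg_iota:
  assumes a: "a \<in> group_algebra G" and \<xi>: "\<xi> \<in> Htilde G N"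
  shows "(\<lambda>n. quasireg_alg G N n a (\<xi> n)) \<in> Htilde G N"
    and "lam_hat_alg G N \<iota> a (\<iota> \<xi>) = \<iota> (\<lambda>n. quasireg_alg G N n a (\<xi> n))"
proof -
  let ?\<eta> = "\<lambda>g n x. a g * quasireg G N n g (\<xi> n) x"
  have fin: "finite {g. a g \<noteq> 0}" and carr: "\<And>g. a g \<noteq> 0 \<Longrightarrow> g \<in> carrier G"
    using a by (auto simp: group_algebra_def)
  have \<eta>: "?\<eta> g \<in> Htilde G N" if "a g \<noteq> 0" for g
    using Htilde_scale[OF Htilde_quasireg[OF \<xi> carr[OF that]]] .
  have eq: "(\<lambda>n. quasireg_alg G N n a (\<xi> n)) = (\<lambda>n x. \<Sum>g | a g \<noteq> 0. ?\<eta> g n x)"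
    by (simp add: quasireg_alg_def)
  show "(\<lambda>n. quasireg_alg G N n a (\<xi> n)) \<in> Htilde G N"
    unfolding eq using iota_sum[OF fin, of ?\<eta>] \<eta> by simp
  have "lam_hat_alg G N \<iota> a (\<iota> \<xi>) = (\<Sum>g | a g \<noteq> 0. \<iota> (?\<eta> g))"
    unfolding lam_hat_alg_def
  proof (intro sum.cong refl)
    fix g assume "g \<in> {g. a g \<noteq> 0}"
    then have g: "g \<in> carrier G"
      using carr by simp
    show "a g *\<^sub>C lam_hat G N \<iota> g (\<iota> \<xi>) = \<iota> (?\<eta> g)"
      using lam_hat[OF g] \<xi> iota_scale[OF Htilde_quasireg[OF \<xi> g]] by simp
  qed
  also have "\<dots> = \<iota> (\<lambda>n. quasireg_alg G N n a (\<xi> n))"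
    unfolding eq using iota_sum[OF fin, of ?\<eta>] \<eta> by simp
  finally show "lam_hat_alg G N \<iota> a (\<iota> \<xi>) = \<iota> (\<lambda>n. quasireg_alg G N n a (\<xi> n))" .
qed

text \<open>The limit along \<open>U\<close> of the finite-level estimate: the ratio of \<open>|supp \<xi>\<^sub>n|\<close> to the size of the
  fibres is at most \<open>k\<close> times the ratio that tends to \<open>0\<close> by hypothesis, so only \<open>c \<parallel>\<xi>\<^sub>n\<parallel>\<close> survives.\<close>

lemma lam_hat_alg_growth_le:
  assumes a: "a \<in> group_algebra G" and \<xi>: "\<xi> \<in> Htilde_growth G N \<gamma>"
    and \<gamma>: "growth_less U (\<lambda>n. real (\<gamma> n)) (\<lambda>n. real (\<nu> G N n) / real (\<nu> G N (n - 1)))"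
    and c: "eventually (\<lambda>n. \<rho>_norm G N n a \<le> c) U" "c \<ge> 0"
  shows "norm (lam_hat_alg G N \<iota> a (\<iota> \<xi>)) \<le> c * norm (\<iota> \<xi>)"
proof -
  define K where "K = (\<Sum>g | a g \<noteq> 0. cmod (a g))"
  have K: "K \<ge> 0"
    unfolding K_def by (intro sum_nonneg) auto
  let ?r = "\<lambda>n. real (\<gamma> n) / (real (\<nu> G N n) / real (\<nu> G N (n - 1)))"
  obtain k where \<xi>': "\<xi> \<in> Htilde G N"
    and k: "\<And>n. card {x \<in> X G N n. \<xi> n x \<noteq> 0} \<le> k * \<gamma> n"
    using \<xi> by (auto simp: Htilde_growth_def)
  have "((\<lambda>n. (c + (c + K) * sqrt (real k * ?r n)) * l2_norm (X G N n) (\<xi> n))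
      \<longlongrightarrow> (c + (c + K) * sqrt (real k * 0)) * norm (\<iota> \<xi>)) U"
    using \<gamma> unfolding growth_less_def by (intro tendsto_intros tendsto_norm_iota[OF \<xi>'])
  moreover have "((\<lambda>n. l2_norm (X G N n) (quasireg_alg G N n a (\<xi> n)))
      \<longlongrightarrow> norm (lam_hat_alg G N \<iota> a (\<iota> \<xi>))) U"
    unfolding lam_hat_alg_iota(2)[OF a \<xi>'] by (rule tendsto_norm_iota[OF lam_hat_alg_iota(1)[OF a \<xi>']])
  moreover have "eventually (\<lambda>n. l2_norm (X G N n) (quasireg_alg G N n a (\<xi> n))
      \<le> (c + (c + K) * sqrt (real k * ?r n)) * l2_norm (X G N n) (\<xi> n)) U"
    using c(1)
  proof (rule eventually_mono)
    fix n assume n: "\<rho>_norm G N n a \<le> c"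
    let ?s = "real (card {x \<in> X G N n. \<xi> n x \<noteq> 0}) / (real (\<nu> G N n) / real (\<nu> G N (n - 1)))"
    have "real (card {x \<in> X G N n. \<xi> n x \<noteq> 0}) \<le> real k * real (\<gamma> n)"
      using k[of n] by (simp flip: of_nat_mult)
    then have "?s \<le> real k * real (\<gamma> n) / (real (\<nu> G N n) / real (\<nu> G N (n - 1)))"
      by (rule divide_right_mono) simp
    then have "sqrt ?s \<le> sqrt (real k * ?r n)"
      by simp
    then have "(c + (c + K) * sqrt ?s) * l2_norm (X G N n) (\<xi> n)
        \<le> (c + (c + K) * sqrt (real k * ?r n)) * l2_norm (X G N n) (\<xi> n)"
      using c K by (intro mult_right_mono add_left_mono mult_left_mono) auto
    then show "l2_norm (X G N n) (quasireg_alg G N n a (\<xi> n))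
        \<le> (c + (c + K) * sqrt (real k * ?r n)) * l2_norm (X G N n) (\<xi> n)"
      using quasireg_alg_small_support_le[OF a Htilde_l2[OF \<xi>'] n c(2)] unfolding K_def by linarith
  qed
  ultimately show ?thesis
    by (auto dest: tendsto_le[OF U_nontrivial])
qed

lemma iota_null: "\<zeta> \<in> Hnull G N U \<Longrightarrow> \<iota> \<zeta> = 0"
  using norm_eq_sqrt_cinner[of "\<iota> \<zeta>"] by (simp add: Hnull_def cinner_iota)

text \<open>The inequality is a closed condition on \<open>v\<close>, and adding a null sequence does not change the
  image under \<open>\<iota>\<close>.\<close>

lemma lam_hat_alg_H_growth_le:
  assumes a: "a \<in> group_algebra G" and v: "v \<in> H_growth G N U \<iota> \<gamma>"
    and \<gamma>: "growth_less U (\<lambda>n. real (\<gamma> n)) (\<lambda>n. real (\<nu> G N n) / real (\<nu> G N (n - 1)))"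
    and c: "eventually (\<lambda>n. \<rho>_norm G N n a \<le> c) U" "c \<ge> 0"
  shows "norm (lam_hat_alg G N \<iota> a v) \<le> c * norm v"
proof -
  let ?B = "{v. norm (lam_hat_alg G N \<iota> a v) \<le> c * norm v}"
  have "\<iota> (\<lambda>n x. \<xi> n x + \<zeta> n x) \<in> ?B"
    if "\<xi> \<in> Htilde_growth G N \<gamma>" "\<zeta> \<in> Hnull G N U" for \<xi> \<zeta>
  proof -
    have "\<xi> \<in> Htilde G N" "\<zeta> \<in> Htilde G N"
      using that by (auto simp: Htilde_growth_def Hnull_def)
    then show ?thesis
      using lam_hat_alg_growth_le[OF a that(1) \<gamma> c] by (simp add: iota_add iota_null that(2))
  qed
  moreover have "closed ?B"
    by (rule closed_Collect_le[OF continuous_on_norm[OF continuous_lam_hat_alg[OF a]]])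
      (intro continuous_intros)
  ultimately have "H_growth G N U \<iota> \<gamma> \<subseteq> ?B"
    unfolding H_growth_def by (intro closure_minimal) auto
  then show ?thesis
    using v by blast
qed

lemma zero_in_H_growth: "0 \<in> H_growth G N U \<iota> \<gamma>"
proof -
  have "(\<lambda>n x. 0) \<in> Htilde_growth G N \<gamma>"
    by (auto simp: Htilde_growth_def Htilde_zero)
  moreover have "(\<lambda>n x. 0) \<in> Hnull G N U"
    by (simp add: Hnull_def Htilde_zero Hform_def l2_inner_def tendsto_Lim[OF U_nontrivial])
  ultimately have "(\<lambda>n x. 0) \<in> {\<lambda>n x. \<xi> n x + \<zeta> n x | \<xi> \<zeta>. \<xi> \<in> Htilde_growth G N \<gamma> \<and> \<zeta> \<in> Hnull G N U}"
    by (intro CollectI exI[of _ "\<lambda>n x. 0"] conjI) simp_all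
  then have "\<iota> (\<lambda>n x. 0) \<in> H_growth G N U \<iota> \<gamma>"
    unfolding H_growth_def by (rule subsetD[OF closure_subset imageI])
  then show ?thesis
    by (simp add: iota_zero)
qed

lemma pi_norm_le:
  assumes a: "a \<in> group_algebra G"
    and \<gamma>: "growth_less U (\<lambda>n. real (\<gamma> n)) (\<lambda>n. real (\<nu> G N n) / real (\<nu> G N (n - 1)))"
    and c: "eventually (\<lambda>n. \<rho>_norm G N n a \<le> c) U"
  shows "\<pi>_norm G N U \<iota> \<gamma> a \<le> c"
proof -
  have c0: "c \<ge> 0"
    using eventually_happens'[OF U_nontrivial c] by (auto intro: order_trans[OF rho_norm_nonneg[OF a]])
  show ?thesis
    unfolding \<pi>_norm_def opnorm_on_def
  proof (rule cSUP_least)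
    show "{v \<in> H_growth G N U \<iota> \<gamma>. norm v \<le> 1} \<noteq> {}"
      using zero_in_H_growth by force
  next
    fix v assume "v \<in> {v \<in> H_growth G N U \<iota> \<gamma>. norm v \<le> 1}"
    then show "norm (lam_hat_alg G N \<iota> a v) \<le> c"
      using lam_hat_alg_H_growth_le[OF a _ \<gamma> c c0, of v] mult_left_mono[of "norm v" 1 c] c0 by simp
  qed
qed

end

theorem theorem5p1:
  fixes G :: "('a, 'b) monoid_scheme" (structure)
    and N :: "nat \<Rightarrow> 'a set"
    and U :: "nat filter"
    and \<iota> :: "(nat \<Rightarrow> 'a set \<Rightarrow> complex) \<Rightarrow> 'h::chilbert_space"
    and \<gamma> :: "nat \<Rightarrow> nat"
    and a :: "'a \<Rightarrow> complex"
  assumes "group G"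
    and "normal_chain G N"
    and "nonprincipal_ultrafilter U"
    and "is_completion G N U \<iota>"
    and "\<gamma> \<in> growth_functions G N"
    and "growth_less U (\<lambda>n. real (\<gamma> n)) (\<lambda>n. real (\<nu> G N n) / real (\<nu> G N (n - 1)))"
    and "a \<in> group_algebra G"
  shows "ereal (\<pi>_norm G N U \<iota> \<gamma> a) \<le> limsup (\<lambda>n. ereal (\<rho>_norm G N n a))"
proof (rule ccontr)
  interpret group G by fact
  interpret ultraproduct G N U \<iota>
    by unfold_locales fact+
  assume "\<not> ?thesis"
  then have "limsup (\<lambda>n. ereal (\<rho>_norm G N n a)) < ereal (\<pi>_norm G N U \<iota> \<gamma> a)"
    by simp
  from ereal_dense2[OF this] obtain c where
    c: "limsup (\<lambda>n. ereal (\<rho>_norm G N n a)) < ereal c" "c < \<pi>_norm G N U \<iota> \<gamma> a"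
    by auto
  have "eventually (\<lambda>n. \<rho>_norm G N n a \<le> c) sequentially"
    using Limsup_lessD[OF c(1)] by (rule eventually_mono) simp
  then have "eventually (\<lambda>n. \<rho>_norm G N n a \<le> c) U"
    using nonprincipal_ultrafilter_le_sequentially[OF assms(3)] by (rule filter_leD[rotated])
  from pi_norm_le[OF assms(7,6) this] show False
    using c(2) by simp
qed

end
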